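(* Let $S$ be a Borel quasi-order on a standard Borel space $X$. Then for every $\vec a\in X^\omega$ the equivalence class $\{\vec b\in X^\omega:\vec a\mathrel{E_{S^{\mathrm{inj}}}}\vec b\}$ is Borel.
   Context: $X^\omega$ carries the product standard Borel structure. $S^{\mathrm{inj}}$ is the quasi-order on $X^\omega$ defined by $(x_n)_{n}\mathrel{S^{\mathrm{inj}}}(y_n)_n$ iff there is an injective $f\colon\omega\to\omega$ with $x_n\mathrel S y_{f(n)}$ for all $n$. For a quasi-order $R$, $E_R$ is the equivalence relation $x\mathrel R y\wedge y\mathrel R x$. *)

theory Defs
  imports "HOL-Analysis.Analysis"
begin

text \<open>
  A standard Borel space is a measurable space whose \<open>\<sigma>\<close>-algebra is generated by the
  open sets of some Polish topology on its underlying set. Only \<^term>\<open>space M\<close> and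
  \<^term>\<open>sets M\<close> matter; the measure carried by \<^term>\<open>M\<close> is irrelevant.
\<close>

definition polish_topology :: "'a topology \<Rightarrow> bool" where
  "polish_topology T \<longleftrightarrow> completely_metrizable_space T \<and> separable_space T"

definition standard_borel_space :: "'a measure \<Rightarrow> bool" where
  "standard_borel_space M \<longleftrightarrow>
    (\<exists>T. polish_topology T \<and> topspace T = space M \<and>
         sets M = sigma_sets (topspace T) {U. openin T U})"

definition borel_quasi_order :: "'a measure \<Rightarrow> 'a rel \<Rightarrow> bool" where
  "borel_quasi_order M S \<longleftrightarrow> preorder_on (space M) S \<and> S \<in> sets (M \<Otimes>\<^sub>M M)"

abbreviation omega_power :: "'a measure \<Rightarrow> (nat \<Rightarrow> 'a) measure" where
  "omega_power M \<equiv> (\<Pi>\<^sub>M n\<in>(UNIV :: nat set). M)"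

definition inj_quasi_order :: "'a measure \<Rightarrow> 'a rel \<Rightarrow> (nat \<Rightarrow> 'a) rel" where
  "inj_quasi_order M S =
    {(x, y). x \<in> space (omega_power M) \<and> y \<in> space (omega_power M) \<and>
             (\<exists>f :: nat \<Rightarrow> nat. inj f \<and> (\<forall>n. (x n, y (f n)) \<in> S))}"

definition assoc_equiv :: "'b rel \<Rightarrow> 'b rel" where
  "assoc_equiv R = {(x, y). (x, y) \<in> R \<and> (y, x) \<in> R}"

end

theory Submission
  imports Defs
begin

text \<open>
  Fix \<open>a\<close> and call an index \<open>m\<close> ample if it lies in a set of indices whose
  members each have infinitely many members of the set \<open>S\<close>-above them. If injections \<open>f\<close> and \<open>g\<close>
  witness that \<open>a\<close> and \<open>b\<close> are equivalent, then the orbit of \<open>m\<close> under the injection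
  \<open>g \<circ> f\<close> is either infinite, which makes \<open>m\<close> ample, or a cycle, all of whose members
  are equivalent. So the values \<open>a m\<close> at non-ample indices have finite equivalence
  classes, each met by \<open>b\<close> equally often, while every other \<open>b n\<close> lies below an ample
  \<open>a m\<close>, and each ample \<open>a m\<close> lies below infinitely many of these other \<open>b n\<close>.
  Conversely, these conditions suffice: the finite classes are matched bijectively, and
  the remaining indices have infinitely many admissible targets and are matched greedily.
  As \<open>a\<close> is fixed, the conditions only involve countable quantifiers over \<open>S\<close>.
\<close>

section \<open>Ample indices and tied values\<close>

definition ample :: "'a rel \<Rightarrow> (nat \<Rightarrow> 'a) \<Rightarrow> nat set" where
  "ample S a = \<Union>{G. \<forall>m\<in>G. infinite {k\<in>G. (a m, a k) \<in> S}}"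

text \<open>A set of values rather than of indices, so that it also splits the entries of a second
  sequence \<open>b\<close>.\<close>

definition tied :: "'a rel \<Rightarrow> (nat \<Rightarrow> 'a) \<Rightarrow> 'a set" where
  "tied S a = {x. \<exists>m. m \<notin> ample S a \<and> (x, a m) \<in> assoc_equiv S}"

lemma ampleI:
  assumes "m \<in> G" "\<And>m. m \<in> G \<Longrightarrow> infinite {k\<in>G. (a m, a k) \<in> S}"
  shows "m \<in> ample S a"
  using assms unfolding ample_def by blast

text \<open>A witness \<open>G\<close> for \<open>m\<close> consists of ample indices. Hence
  \<open>ample S a\<close> itself has the property required of \<open>G\<close> and is the largest
  such set.\<close>

lemma infinite_ample_above:
  assumes "m \<in> ample S a"
  shows "infinite {k \<in> ample S a. (a m, a k) \<in> S}"
proof -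
  obtain G where G: "m \<in> G" "\<forall>m\<in>G. infinite {k\<in>G. (a m, a k) \<in> S}"
    using assms unfolding ample_def by blast
  then have "{k\<in>G. (a m, a k) \<in> S} \<subseteq> {k \<in> ample S a. (a m, a k) \<in> S}"
    unfolding ample_def by blast
  with G show ?thesis
    by (meson finite_subset)
qed

text \<open>Adding \<open>k\<close> to the ample set keeps the defining property, since
  \<open>k\<close> inherits by transitivity everything above \<open>m\<close>.\<close>

lemma ample_downward:
  assumes "trans S" "m \<in> ample S a" "(a k, a m) \<in> S"
  shows "k \<in> ample S a"
proof (rule ampleI)
  show "k \<in> insert k (ample S a)" by simp
next
  fix i assume i: "i \<in> insert k (ample S a)"
  show "infinite {j \<in> insert k (ample S a). (a i, a j) \<in> S}"
  proof (cases "i \<in> ample S a")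
    case True
    show ?thesis
      by (rule infinite_super[OF _ infinite_ample_above[OF True]]) auto
  next
    case False
    with i have "i = k" by simp
    then show ?thesis
      using transD[OF assms(1,3)]
      by (intro infinite_super[OF _ infinite_ample_above[OF assms(2)]]) blast
  qed
qed

text \<open>Each member of an infinite class has the whole class above it, so the class would be a
  witness \<open>G\<close>, and \<open>m\<close> would be ample as well.\<close>

lemma finite_class_if_not_ample:
  assumes "trans S" "m \<notin> ample S a"
  shows "finite {k. (a k, a m) \<in> assoc_equiv S}"
proof (rule ccontr)
  let ?C = "{k. (a k, a m) \<in> assoc_equiv S}"
  assume inf: "infinite ?C"
  have "infinite {k \<in> ?C. (a i, a k) \<in> S}" if "i \<in> ?C" for i
  proof (rule infinite_super[OF _ inf])
    show "?C \<subseteq> {k \<in> ?C. (a i, a k) \<in> S}"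
      using that transD[OF assms(1)] by (auto simp: assoc_equiv_def)
  qed
  then have "?C \<subseteq> ample S a"
    using ampleI[of _ ?C] by blast
  moreover obtain k where "k \<in> ?C"
    using inf by (metis (no_types, lifting) ex_in_conv finite.emptyI)
  ultimately have "k \<in> ample S a" "(a m, a k) \<in> S"
    by (auto simp: assoc_equiv_def)
  with ample_downward[OF assms(1)] assms(2) show False by blast
qed

section \<open>Orbits of an ascending injection\<close>

lemma orbit_ascends:
  assumes "trans S" "\<And>n. (a n, a n) \<in> S" "\<And>n. (a n, a (h n)) \<in> S" "i \<le> j"
  shows "(a ((h ^^ i) m), a ((h ^^ j) m)) \<in> S"
  using assms(4)
proof (induction j rule: dec_induct)
  case base
  then show ?case using assms(2) by blast
next
  case (step j)
  then show ?case using transD[OF assms(1) step.IH assms(3)] by simp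
qed

text \<open>An infinite orbit of \<open>m\<close> would be a witness \<open>G\<close>, since every
  point has all later ones above it. So the orbit is a cycle; the \<open>j\<close> obtained is the
  predecessor of \<open>m\<close> on it.\<close>

lemma orbit_returns_if_not_ample:
  assumes "trans S" "\<And>n. (a n, a n) \<in> S" "\<And>n. (a n, a (h n)) \<in> S" "inj h"
    and "m \<notin> ample S a"
  obtains j where "h j = m" "(a m, a j) \<in> S" "(a (h m), a m) \<in> S"
proof -
  note mono = orbit_ascends[of S a h, OF assms(1-3)]
  have "\<not> inj (\<lambda>i. (h ^^ i) m)"
  proof
    assume inj: "inj (\<lambda>i. (h ^^ i) m)"
    have "infinite {k \<in> range (\<lambda>i. (h ^^ i) m). (a l, a k) \<in> S}"
      if "l \<in> range (\<lambda>i. (h ^^ i) m)" for l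
    proof -
      obtain i where i: "l = (h ^^ i) m" using \<open>l \<in> _\<close> by blast
      have "infinite ((\<lambda>i. (h ^^ i) m) ` {i..})"
        using finite_imageD[OF _ inj_on_subset[OF inj subset_UNIV]] infinite_Ici by blast
      moreover have "(\<lambda>i. (h ^^ i) m) ` {i..} \<subseteq>
          {k \<in> range (\<lambda>i. (h ^^ i) m). (a l, a k) \<in> S}"
        using mono unfolding i by blast
      ultimately show ?thesis
        using infinite_super by blast
    qed
    moreover have "m \<in> range (\<lambda>i. (h ^^ i) m)"
      by (rule range_eqI[of _ _ 0]) simp
    ultimately have "m \<in> ample S a"
      by (intro ampleI[of m "range (\<lambda>i. (h ^^ i) m)"])
    with assms(5) show False ..
  qed
  then obtain i j where "i \<noteq> j" "(h ^^ i) m = (h ^^ j) m"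
    unfolding inj_def by blast
  then obtain i j where "i < j" "(h ^^ i) m = (h ^^ j) m"
    by (cases i j rule: linorder_cases) auto
  \<comment> \<open>The period is written \<open>Suc p\<close>, so that it is positive and
    \<open>(h ^^ p) m\<close> is the predecessor sought.\<close>
  then obtain p where "(h ^^ i) m = (h ^^ (i + Suc p)) m"
    by (auto dest: less_imp_Suc_add)
  then have "(h ^^ i) m = (h ^^ i) ((h ^^ Suc p) m)"
    by (simp only: funpow_add comp_apply)
  then have p: "(h ^^ Suc p) m = m"
    using injD[OF inj_fn[OF assms(4)]] by metis
  show thesis
  proof
    show "h ((h ^^ p) m) = m" using p by simp
    show "(a m, a ((h ^^ p) m)) \<in> S" using mono[of 0 p m] by simp
    show "(a (h m), a m) \<in> S" using mono[of 1 "Suc p" m] p by simp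
  qed
qed

lemma tied_iff_not_ample:
  assumes "trans S" "\<And>n. (a n, a n) \<in> S"
  shows "a m \<in> tied S a \<longleftrightarrow> m \<notin> ample S a"
  using ample_downward[OF assms(1)] assms(2)
  unfolding tied_def assoc_equiv_def by blast

section \<open>Necessity of the conditions\<close>

lemma mutual_injections_imp:
  fixes a b :: "nat \<Rightarrow> 'a"
  assumes S: "trans S" "\<And>n. (a n, a n) \<in> S"
    and f: "inj f" "\<And>n. (a n, b (f n)) \<in> S"
    and g: "inj g" "\<And>n. (b n, a (g n)) \<in> S"
  shows class_card: "\<And>m. m \<notin> ample S a \<Longrightarrow> finite {n. (b n, a m) \<in> assoc_equiv S} \<and>
      card {n. (b n, a m) \<in> assoc_equiv S} = card {k. (a k, a m) \<in> assoc_equiv S}"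
    and below_ample: "\<And>n. b n \<notin> tied S a \<Longrightarrow> \<exists>m\<in>ample S a. (b n, a m) \<in> S"
    and above_ample: "\<And>m. m \<in> ample S a \<Longrightarrow> infinite {n. b n \<notin> tied S a \<and> (a m, b n) \<in> S}"
proof -
  note trans = transD[OF S(1)]
  have h: "inj (g \<circ> f)" "\<And>n. (a n, a ((g \<circ> f) n)) \<in> S"
    using inj_compose[OF g(1) f(1)] trans[OF f(2) g(2)] by simp_all
  note returns = orbit_returns_if_not_ample[of S a "g \<circ> f", OF S h(2,1)]
  \<comment> \<open>The predecessor \<open>j\<close> of \<open>g n\<close> on its cycle satisfies
    \<open>f j = n\<close> as \<open>g\<close> is injective, so \<open>b n\<close> sits between
    \<open>a j\<close> and \<open>a (g n)\<close> on the cycle.\<close>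
  have g_back: "(a (g n), b n) \<in> S" if n: "g n \<notin> ample S a" for n
  proof -
    obtain j where "(g \<circ> f) j = g n" "(a (g n), a j) \<in> S"
      using returns[OF n] by blast
    moreover from this have "f j = n" using g(1) by (auto dest: injD)
    ultimately show ?thesis using f(2) trans by blast
  qed
  {
    fix m assume m: "m \<notin> ample S a"
    let ?C = "{k. (a k, a m) \<in> assoc_equiv S}" and ?D = "{n. (b n, a m) \<in> assoc_equiv S}"
    have "f k \<in> ?D" if "k \<in> ?C" for k
    proof -
      have "k \<notin> ample S a"
        using that m ample_downward[OF S(1)] by (auto simp: assoc_equiv_def)
      then have "(a (g (f k)), a k) \<in> S"
        using returns[of k] by auto
      then have "(b (f k), a k) \<in> S" using g(2) trans by blast
      then show ?thesis
        using that f(2)[of k] trans unfolding assoc_equiv_def by blast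
    qed
    then have fC: "f ` ?C \<subseteq> ?D" by blast
    have "g n \<in> ?C" if "n \<in> ?D" for n
    proof -
      have "(a m, a (g n)) \<in> S"
        using that g(2) trans by (auto simp: assoc_equiv_def)
      moreover from this have "g n \<notin> ample S a"
        using m ample_downward[OF S(1)] by blast
      ultimately show ?thesis
        using that g_back trans unfolding assoc_equiv_def by blast
    qed
    then have gD: "g ` ?D \<subseteq> ?C" by blast
    have finC: "finite ?C" by (rule finite_class_if_not_ample[OF S(1) m])
    have finD: "finite ?D"
      using gD finC g(1) by (meson finite_imageD finite_subset inj_on_subset subset_UNIV)
    have "card ?C \<le> card ?D"
      using fC finD f(1) by (meson card_inj_on_le inj_on_subset subset_UNIV)
    moreover have "card ?D \<le> card ?C"
      using gD finC g(1) by (meson card_inj_on_le inj_on_subset subset_UNIV)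
    ultimately show "finite ?D \<and> card ?D = card ?C" using finD by simp
  }
  \<comment> \<open>The witness is \<open>g n\<close>: were it not ample, \<open>g_back\<close>
    would make \<open>b n\<close> equivalent to \<open>a (g n)\<close>, hence tied.\<close>
  show "\<exists>m\<in>ample S a. (b n, a m) \<in> S" if "b n \<notin> tied S a" for n
    using that g(2)[of n] g_back[of n] unfolding tied_def assoc_equiv_def by blast
  show "infinite {n. b n \<notin> tied S a \<and> (a m, b n) \<in> S}" if m: "m \<in> ample S a" for m
  proof (rule infinite_super)
    show "infinite (f ` {k \<in> ample S a. (a m, a k) \<in> S})"
      using infinite_ample_above[OF m] f(1)
      by (meson finite_imageD inj_on_subset subset_UNIV)
    have "b (f k) \<notin> tied S a" if k: "k \<in> ample S a" for k
    proof
      assume "b (f k) \<in> tied S a"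
      then obtain c where c: "c \<notin> ample S a" "(a c, b (f k)) \<in> S"
        unfolding tied_def assoc_equiv_def by blast
      \<comment> \<open>Otherwise \<open>g (f k)\<close> lies on a cycle whose preceding point is
        \<open>k\<close>, which puts it below the ample index \<open>k\<close>.\<close>
      have "g (f k) \<in> ample S a"
      proof (rule ccontr)
        assume n: "g (f k) \<notin> ample S a"
        obtain j where "(g \<circ> f) j = g (f k)" "(a (g (f k)), a j) \<in> S"
          using returns[OF n] by blast
        moreover from this have "j = k"
          using h(1) by (metis comp_apply injD)
        ultimately show False
          using n ample_downward[OF S(1) k] by blast
      qed
      moreover have "(a c, a (g (f k))) \<in> S" using c(2) g(2) trans by blast
      ultimately show False
        using c(1) ample_downward[OF S(1)] by blast
    qed
    then show "f ` {k \<in> ample S a. (a m, a k) \<in> S} \<subseteq> {n. b n \<notin> tied S a \<and> (a m, b n) \<in> S}"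
      using f(2) trans by blast
  qed
qed

section \<open>Building injections\<close>

lemma inj_choice_from_infinite_sets:
  fixes N :: "nat \<Rightarrow> nat set"
  assumes "\<And>x. infinite (N x)"
  obtains f where "inj f" "\<And>x. f x \<in> N x"
proof -
  \<comment> \<open>Greedy choice: strictly increasing values make injectivity automatic.\<close>
  have "\<exists>f. \<forall>x. f x \<in> N x \<and> f x < f (Suc x)"
  proof (rule dependent_nat_choice)
    show "\<exists>y. y \<in> N 0"
      using assms[of 0] by (metis ex_in_conv finite.emptyI)
    show "\<exists>z. z \<in> N (Suc x) \<and> y < z" for x y
      using assms[of "Suc x"] infinite_nat_iff_unbounded by blast
  qed
  then obtain f where f: "\<And>x. f x \<in> N x" "\<And>x. f x < f (Suc x)" by blast
  then have "inj f" by (simp add: strict_mono_Suc_iff strict_mono_imp_inj_on)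
  with f(1) show thesis by (intro that)
qed

text \<open>Finite fibres inject one by one; images of different fibres are disjoint because
  \<open>q\<close> recovers the common label.\<close>

lemma inj_on_by_fibres:
  assumes "\<And>x. x \<in> P \<Longrightarrow> finite {y\<in>P. p y = p x}"
    and "\<And>x. x \<in> P \<Longrightarrow> finite {y\<in>Q. q y = p x}"
    and "\<And>x. x \<in> P \<Longrightarrow> card {y\<in>P. p y = p x} \<le> card {y\<in>Q. q y = p x}"
  obtains f where "inj_on f P" "\<And>x. x \<in> P \<Longrightarrow> f x \<in> Q \<and> q (f x) = p x"
proof -
  have "\<forall>c\<in>p ` P. \<exists>f. f ` {y\<in>P. p y = c} \<subseteq> {y\<in>Q. q y = c} \<and> inj_on f {y\<in>P. p y = c}"
    (is "\<forall>c\<in>_. \<exists>f. ?I c f")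
  proof
    fix c assume "c \<in> p ` P"
    then obtain x where "x \<in> P" "c = p x" by blast
    then show "\<exists>f. ?I c f"
      using card_le_inj[OF assms(1-3)[of x]] by simp
  qed
  from bchoice[OF this] obtain F where F: "\<forall>c\<in>p ` P. ?I c (F c)" ..
  have Q: "F (p x) x \<in> Q \<and> q (F (p x) x) = p x" if "x \<in> P" for x
    using F that by blast
  have "inj_on (\<lambda>x. F (p x) x) P"
  proof (rule inj_onI)
    fix x y assume xy: "x \<in> P" "y \<in> P" "F (p x) x = F (p y) y"
    then have "p y = p x" using Q[of x] Q[of y] by simp
    then show "x = y" using F xy by (intro inj_onD[of "F (p x)" "{y\<in>P. p y = p x}" x y]) simp_all
  qed
  with Q show thesis using that by blast
qed

text \<open>The two partial injections cannot collide: one lands where \<open>v\<close> is in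
  \<open>T\<close>, the other where it is not.\<close>

lemma combined_injection:
  fixes u v :: "nat \<Rightarrow> 'a"
  assumes "inj_on f {x. u x \<in> T}"
    and "\<And>x. u x \<in> T \<Longrightarrow> v (f x) \<in> T \<and> (u x, v (f x)) \<in> S"
    and "\<And>x. u x \<notin> T \<Longrightarrow> infinite {y. v y \<notin> T \<and> (u x, v y) \<in> S}"
  shows "\<exists>h. inj h \<and> (\<forall>x. (u x, v (h x)) \<in> S)"
proof -
  \<comment> \<open>\<open>UNIV\<close> is a dummy target where \<open>u x\<close> is in
    \<open>T\<close>; there \<open>h\<close> uses \<open>f\<close> instead of
    \<open>e\<close>.\<close>
  obtain e where e: "inj e"
    "\<And>x. e x \<in> (if u x \<in> T then UNIV else {y. v y \<notin> T \<and> (u x, v y) \<in> S})"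
    by (rule inj_choice_from_infinite_sets
        [of "\<lambda>x. if u x \<in> T then UNIV else {y. v y \<notin> T \<and> (u x, v y) \<in> S}"])
      (use assms(3) in auto)
  define h where "h x = (if u x \<in> T then f x else e x)" for x
  have e': "v (e x) \<notin> T \<and> (u x, v (e x)) \<in> S" if "u x \<notin> T" for x
    using e(2)[of x] that by simp
  have "inj h"
  proof (rule injI)
    fix x y assume "h x = h y"
    moreover have "u z \<in> T \<longleftrightarrow> v (h z) \<in> T" for z
      using assms(2)[of z] e'[of z] by (cases "u z \<in> T") (simp_all add: h_def)
    ultimately have "u x \<in> T \<longleftrightarrow> u y \<in> T" by metis
    with \<open>h x = h y\<close> show "x = y"
      using inj_onD[OF assms(1), of x y] injD[OF e(1), of x y]
      by (cases "u x \<in> T") (simp_all add: h_def)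
  qed
  moreover have "\<forall>x. (u x, v (h x)) \<in> S"
    using assms(2) e' by (simp add: h_def)
  ultimately show ?thesis by blast
qed

section \<open>Sufficiency of the conditions\<close>

lemma mutual_injections_if:
  fixes a b :: "nat \<Rightarrow> 'a"
  assumes S: "trans S" "\<And>n. (a n, a n) \<in> S"
    and card: "\<And>m. m \<notin> ample S a \<Longrightarrow> finite {n. (b n, a m) \<in> assoc_equiv S} \<and>
      card {n. (b n, a m) \<in> assoc_equiv S} = card {k. (a k, a m) \<in> assoc_equiv S}"
    and below: "\<And>n. b n \<notin> tied S a \<Longrightarrow> \<exists>m\<in>ample S a. (b n, a m) \<in> S"
    and above: "\<And>m. m \<in> ample S a \<Longrightarrow> infinite {n. b n \<notin> tied S a \<and> (a m, b n) \<in> S}"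
  shows "\<exists>f. inj f \<and> (\<forall>n. (a n, b (f n)) \<in> S)"
    and "\<exists>g. inj g \<and> (\<forall>n. (b n, a (g n)) \<in> S)"
proof -
  note trans = transD[OF S(1)]
  note tied_iff = tied_iff_not_ample[of S a, OF S]
  \<comment> \<open>A label comparable across \<open>a\<close> and \<open>b\<close>. For tied values
    it is nonempty and so determines the equivalence class; untied values may share the empty
    label.\<close>
  define cls where "cls x = {k. (x, a k) \<in> assoc_equiv S}" for x
  have cls_eq: "cls x = cls y \<longleftrightarrow> (x, y) \<in> assoc_equiv S"
    if "x \<in> tied S a" for x y
  proof
    assume eq: "cls x = cls y"
    obtain m where "m \<in> cls x" using \<open>x \<in> tied S a\<close> unfolding tied_def cls_def by blast
    moreover from this have "m \<in> cls y" using eq by simp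
    ultimately show "(x, y) \<in> assoc_equiv S"
      using trans unfolding cls_def assoc_equiv_def by blast
  next
    assume "(x, y) \<in> assoc_equiv S"
    then show "cls x = cls y"
      using trans unfolding cls_def assoc_equiv_def by blast
  qed
  have fibre: "{n. u n \<in> tied S a \<and> cls (u n) = cls x} = {n. (u n, a m) \<in> assoc_equiv S}"
    if "m \<notin> ample S a" "(x, a m) \<in> assoc_equiv S" for u :: "nat \<Rightarrow> 'a" and x m
  proof -
    have "x \<in> tied S a" using that unfolding tied_def by blast
    then have "cls x = cls (a m)" using that cls_eq by blast
    moreover have "u n \<in> tied S a" if "(u n, a m) \<in> assoc_equiv S" for n
      using \<open>m \<notin> ample S a\<close> that unfolding tied_def by blast
    ultimately have "u n \<in> tied S a \<and> cls (u n) = cls x \<longleftrightarrow> (u n, a m) \<in> assoc_equiv S" for n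
      using cls_eq[of "u n" "a m"] by metis
    then show ?thesis by simp
  qed
  have fibres: "finite {n. a n \<in> tied S a \<and> cls (a n) = cls x} \<and>
      finite {n. b n \<in> tied S a \<and> cls (b n) = cls x} \<and>
      card {n. b n \<in> tied S a \<and> cls (b n) = cls x} =
      card {n. a n \<in> tied S a \<and> cls (a n) = cls x}"
    if x: "x \<in> tied S a" for x
  proof -
    obtain m where m: "m \<notin> ample S a" "(x, a m) \<in> assoc_equiv S"
      using x unfolding tied_def by blast
    show ?thesis
      unfolding fibre[OF m] using card[OF m(1)] finite_class_if_not_ample[OF S(1) m(1)] by simp
  qed
  have cls_S: "(x, y) \<in> S" if "x \<in> tied S a" "cls y = cls x" for x y
    using cls_eq[of x y] that by (simp add: assoc_equiv_def)
  obtain f where f: "inj_on f {n. a n \<in> tied S a}"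
    "\<And>n. n \<in> {n. a n \<in> tied S a} \<Longrightarrow> f n \<in> {n. b n \<in> tied S a} \<and> cls (b (f n)) = cls (a n)"
    by (rule inj_on_by_fibres[of "{n. a n \<in> tied S a}" "\<lambda>n. cls (a n)"
          "{n. b n \<in> tied S a}" "\<lambda>n. cls (b n)"]) (use fibres in auto)
  show "\<exists>f. inj f \<and> (\<forall>n. (a n, b (f n)) \<in> S)"
    using f above tied_iff cls_S by (intro combined_injection[OF f(1)]) simp_all
  obtain g where g: "inj_on g {n. b n \<in> tied S a}"
    "\<And>n. n \<in> {n. b n \<in> tied S a} \<Longrightarrow> g n \<in> {n. a n \<in> tied S a} \<and> cls (a (g n)) = cls (b n)"
    by (rule inj_on_by_fibres[of "{n. b n \<in> tied S a}" "\<lambda>n. cls (b n)"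
          "{n. a n \<in> tied S a}" "\<lambda>n. cls (a n)"]) (use fibres in auto)
  \<comment> \<open>Some ample \<open>m\<close> lies above \<open>b n\<close>, and infinitely many
    ample, hence untied, indices of \<open>a\<close> lie above \<open>m\<close>.\<close>
  have "infinite {k. a k \<notin> tied S a \<and> (b n, a k) \<in> S}" if n: "b n \<notin> tied S a" for n
  proof -
    obtain m where m: "m \<in> ample S a" "(b n, a m) \<in> S" using below[OF n] by blast
    show ?thesis
      by (rule infinite_super[OF _ infinite_ample_above[OF m(1)]])
        (use m(2) trans tied_iff in blast)
  qed
  then show "\<exists>g. inj g \<and> (\<forall>n. (b n, a (g n)) \<in> S)"
    using g cls_S by (intro combined_injection[OF g(1)]) simp_all
qed

section \<open>Borel form of the conditions\<close>

lemma finite_card_eq_iff_distinct_list: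
  "finite A \<and> card A = k \<longleftrightarrow> (\<exists>xs. distinct xs \<and> length xs = k \<and> (\<forall>x. x \<in> A \<longleftrightarrow> x \<in> set xs))"
  by (metis distinct_card finite_distinct_list finite_set set_eqI)

theorem theorem3p31:
  fixes M :: "'a measure" and S :: "'a rel"
  assumes "standard_borel_space M"
    and "borel_quasi_order M S"
  shows "\<forall>a \<in> space (omega_power M).
    {b \<in> space (omega_power M). (a, b) \<in> assoc_equiv (inj_quasi_order M S)}
      \<in> sets (omega_power M)"
proof
  fix a assume a: "a \<in> space (omega_power M)"
  have trans: "trans S" and refl: "\<And>x. x \<in> space M \<Longrightarrow> (x, x) \<in> S"
    and [measurable]: "S \<in> sets (M \<Otimes>\<^sub>M M)"
    using assms(2) unfolding borel_quasi_order_def preorder_on_def by (auto dest: refl_onD)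
  have aM [measurable]: "a n \<in> space M" for n
    using a by (auto simp: space_PiM)
  have a_refl: "(a n, a n) \<in> S" for n using refl aM by blast
  \<comment> \<open>All quantifiers range over the countable types \<open>nat\<close> and
    \<open>nat list\<close>: an enumerating list \<open>xs\<close> expresses finiteness with
    prescribed cardinality, and unboundedness expresses infinity. Ampleness depends on
    \<open>a\<close> only, so just the atoms comparing \<open>b n\<close> with \<open>a m\<close>
    vary with \<open>b\<close>.\<close>
  let ?\<Phi> = "\<lambda>b. (\<forall>m. m \<notin> ample S a \<longrightarrow> (\<exists>xs::nat list. distinct xs \<and>
        length xs = card {k. (a k, a m) \<in> assoc_equiv S} \<and>
        (\<forall>n. ((b n, a m) \<in> S \<and> (a m, b n) \<in> S) \<longleftrightarrow> n \<in> set xs))) \<and>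
      (\<forall>n. (\<exists>m. m \<notin> ample S a \<and> (b n, a m) \<in> S \<and> (a m, b n) \<in> S) \<or>
        (\<exists>m. m \<in> ample S a \<and> (b n, a m) \<in> S)) \<and>
      (\<forall>m. m \<in> ample S a \<longrightarrow> (\<forall>l. \<exists>n. l < n \<and>
        \<not> (\<exists>m. m \<notin> ample S a \<and> (b n, a m) \<in> S \<and> (a m, b n) \<in> S) \<and> (a m, b n) \<in> S))"
  have "(a, b) \<in> assoc_equiv (inj_quasi_order M S) \<longleftrightarrow> ?\<Phi> b"
    if b: "b \<in> space (omega_power M)" for b
  proof -
    have "(a, b) \<in> assoc_equiv (inj_quasi_order M S) \<longleftrightarrow>
        (\<exists>f. inj f \<and> (\<forall>n. (a n, b (f n)) \<in> S)) \<and> (\<exists>g. inj g \<and> (\<forall>n. (b n, a (g n)) \<in> S))"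
      using a b unfolding assoc_equiv_def inj_quasi_order_def by simp
    also have "\<dots> \<longleftrightarrow>
        (\<forall>m. m \<notin> ample S a \<longrightarrow> finite {n. (b n, a m) \<in> assoc_equiv S} \<and>
          card {n. (b n, a m) \<in> assoc_equiv S} = card {k. (a k, a m) \<in> assoc_equiv S}) \<and>
        (\<forall>n. b n \<in> tied S a \<or> (\<exists>m. m \<in> ample S a \<and> (b n, a m) \<in> S)) \<and>
        (\<forall>m. m \<in> ample S a \<longrightarrow> infinite {n. b n \<notin> tied S a \<and> (a m, b n) \<in> S})"
      (is "?L \<longleftrightarrow> ?R")
    proof
      assume ?L
      then obtain f g where fg: "inj f" "\<And>n. (a n, b (f n)) \<in> S"
        "inj g" "\<And>n. (b n, a (g n)) \<in> S" by blast
      note * = mutual_injections_imp[of S a f b g, OF trans a_refl fg]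
      show ?R using * by blast
    next
      assume R: ?R
      show ?L
        by (intro conjI mutual_injections_if[of S a b, OF trans a_refl]) (use R in blast)+
    qed
    also have "\<dots> \<longleftrightarrow> ?\<Phi> b"
      unfolding finite_card_eq_iff_distinct_list infinite_nat_iff_unbounded tied_def
      by (simp add: assoc_equiv_def)
    finally show ?thesis .
  qed
  then have "{b \<in> space (omega_power M). (a, b) \<in> assoc_equiv (inj_quasi_order M S)} =
      {b \<in> space (omega_power M). ?\<Phi> b}" by blast
  also have "\<dots> \<in> sets (omega_power M)"
    by measurable
  finally show "{b \<in> space (omega_power M). (a, b) \<in> assoc_equiv (inj_quasi_order M S)}
      \<in> sets (omega_power M)" .
qed

end
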